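(* Let $R$ be a commutative, associative, unital ring. For any $R$-module $M$, $\text{Soc}(M)\subseteq \text{Red}(M)$.
   Context: All modules are unital right $R$-modules. An $R$-module $M$ is reduced if for all $r\in R$ and $m\in M$, $mr^{2}=0$ implies $mr=0$; a submodule is reduced if it is reduced as a module. $\text{Red}(M)$ denotes the sum of all reduced submodules of $M$, and $\text{Soc}(M)$ denotes the sum of all simple submodules of $M$. *)

theory Defs
  imports "HOL-Algebra.Module"
begin

(* HOL-Algebra writes scalars on the left; over a commutative ring this agrees with the
   right-module notation: m r is rendered as r \<odot> m. *)

locale reduced_module = module +
  assumes reduced:
    "\<lbrakk>r \<in> carrier R; m \<in> carrier M; (r [^]\<^bsub>R\<^esub> (2::nat)) \<odot>\<^bsub>M\<^esub> m = \<zero>\<^bsub>M\<^esub>\<rbrakk>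
      \<Longrightarrow> r \<odot>\<^bsub>M\<^esub> m = \<zero>\<^bsub>M\<^esub>"

locale simple_module = module +
  assumes nonzero: "carrier M \<noteq> {\<zero>\<^bsub>M\<^esub>}"
    and only_trivial_submodules:
      "submodule N R M \<Longrightarrow> N = {\<zero>\<^bsub>M\<^esub>} \<or> N = carrier M"

definition reduced_submodule ::
    "'b set \<Rightarrow> ('a, 'm) ring_scheme \<Rightarrow> ('a, 'b, 'n) module_scheme \<Rightarrow> bool" where
  "reduced_submodule N R M \<longleftrightarrow> submodule N R M \<and> reduced_module R (M\<lparr>carrier := N\<rparr>)"

definition simple_submodule ::
    "'b set \<Rightarrow> ('a, 'm) ring_scheme \<Rightarrow> ('a, 'b, 'n) module_scheme \<Rightarrow> bool" where
  "simple_submodule N R M \<longleftrightarrow> submodule N R M \<and> simple_module R (M\<lparr>carrier := N\<rparr>)"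

(* The (internal) sum of a possibly infinite family of submodules: all finite sums with at most
   one summand from each member. The sum of the empty family is the zero submodule. *)
definition submodule_sum :: "('a, 'b, 'n) module_scheme \<Rightarrow> 'b set set \<Rightarrow> 'b set" where
  "submodule_sum M \<N> =
    {finsum M f F | f F. finite F \<and> F \<subseteq> \<N> \<and> (\<forall>N\<in>F. f N \<in> N)}"

definition Red :: "('a, 'm) ring_scheme \<Rightarrow> ('a, 'b, 'n) module_scheme \<Rightarrow> 'b set" where
  "Red R M = submodule_sum M {N. reduced_submodule N R M}"

definition Soc :: "('a, 'm) ring_scheme \<Rightarrow> ('a, 'b, 'n) module_scheme \<Rightarrow> 'b set" where
  "Soc R M = submodule_sum M {N. simple_submodule N R M}"

end

theory Submission
  imports Defs
begin

text \<open>On a simple module each scalar \<open>r\<close> acts injectively or as zero, because its kernel is a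
  submodule. If \<open>r\<^sup>2 m = 0\<close>, then \<open>r m\<close> lies in that kernel, and both cases give \<open>r m = 0\<close>. Hence
  every simple submodule is one of the summands of the reduced part.\<close>

lemma (in module) smult_kernel_submodule:
  assumes r: "r \<in> carrier R"
  shows "submodule {m \<in> carrier M. r \<odot>\<^bsub>M\<^esub> m = \<zero>\<^bsub>M\<^esub>} R M"
proof (rule submoduleI)
  fix s m assume s: "s \<in> carrier R" and m: "m \<in> {m \<in> carrier M. r \<odot>\<^bsub>M\<^esub> m = \<zero>\<^bsub>M\<^esub>}"
  \<comment> \<open>Commutativity of \<open>R\<close> lets \<open>r\<close> and \<open>s\<close>
    trade places, so the kernel is closed under scalars.\<close>
  have "r \<odot>\<^bsub>M\<^esub> (s \<odot>\<^bsub>M\<^esub> m) = s \<odot>\<^bsub>M\<^esub> (r \<odot>\<^bsub>M\<^esub> m)"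
    using r s m by (metis (lifting) mem_Collect_eq R.m_comm smult_assoc1)
  then show "s \<odot>\<^bsub>M\<^esub> m \<in> {m \<in> carrier M. r \<odot>\<^bsub>M\<^esub> m = \<zero>\<^bsub>M\<^esub>}"
    using s m by simp
qed (use r in \<open>auto simp: smult_r_distr smult_r_minus\<close>)

lemma (in simple_module) reduced_module: "reduced_module R M"
proof
  fix r m
  assume r: "r \<in> carrier R" and m: "m \<in> carrier M"
    and sq: "(r [^]\<^bsub>R\<^esub> (2::nat)) \<odot>\<^bsub>M\<^esub> m = \<zero>\<^bsub>M\<^esub>"
  let ?K = "{m \<in> carrier M. r \<odot>\<^bsub>M\<^esub> m = \<zero>\<^bsub>M\<^esub>}"
  have "r \<odot>\<^bsub>M\<^esub> (r \<odot>\<^bsub>M\<^esub> m) = \<zero>\<^bsub>M\<^esub>"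
    using sq r m by (simp add: numeral_2_eq_2 smult_assoc1)
  then have "r \<odot>\<^bsub>M\<^esub> m \<in> ?K"
    using r m by simp
  moreover have "?K = {\<zero>\<^bsub>M\<^esub>} \<or> ?K = carrier M"
    using smult_kernel_submodule[OF r] by (rule only_trivial_submodules)
  \<comment> \<open>If \<open>?K\<close> is zero, the membership of \<open>r m\<close> in
    \<open>?K\<close> suffices; if \<open>?K\<close> is everything, \<open>m\<close> itself lies in
    \<open>?K\<close>.\<close>
  ultimately show "r \<odot>\<^bsub>M\<^esub> m = \<zero>\<^bsub>M\<^esub>"
    using m by blast
qed

text \<open>Both notions speak of the same module \<open>M\<lparr>carrier := N\<rparr>\<close>, so
  the result on simple modules applies to it directly.\<close>

lemma simple_submodule_imp_reduced_submodule:
  assumes "simple_submodule N R M"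
  shows "reduced_submodule N R M"
  using assms unfolding simple_submodule_def reduced_submodule_def
  by (blast intro: simple_module.reduced_module)

lemma submodule_sum_mono:
  assumes "\<M> \<subseteq> \<N>"
  shows "submodule_sum M \<M> \<subseteq> submodule_sum M \<N>"
  using assms unfolding submodule_sum_def by blast

theorem corollary1:
  fixes R :: "('a, 'm) ring_scheme" and M :: "('a, 'b, 'n) module_scheme"
  assumes "cring R" and "module R M"
  shows "Soc R M \<subseteq> Red R M"
  unfolding Soc_def Red_def
  by (rule submodule_sum_mono) (blast intro: simple_submodule_imp_reduced_submodule)

end
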